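(* Assume that $G^{(2)}(1)=\mathbb E[N(N-1)]$ is finite. Let $1\le i<k$ be integers and let $\mathbf p\in\mathscr Q_k$ be such that $\mathbf p_1=\dots=\mathbf p_i>\mathbf p_{i+1}\ge\dots\ge\mathbf p_k\ge0$. Then $\mathbf p_j(m)\to0$ as $m\to\infty$ for every $j\in\{i+1,\dots,k\}$.
   Context: Let $q=(q_n)_{n\in\mathbb N}$ be a probability distribution on $\mathbb N$ with $q_0+q_1=0$, $N$ a random variable of law $q$, and $G(s)=\mathbb E[s^N]$. $\mathscr P_k:=\{\mathbf p=(\mathbf p_0,\dots,\mathbf p_k)\in(\mathbb R_+)^{k+1}:\sum_{i=0}^k\mathbf p_i=1,\ \mathbf p_0<1\}$ and $\mathscr Q_k:=\{\mathbf p\in\mathscr P_k:\ \mathbf p_1\ge\dots\ge\mathbf p_k\}$. The map $H:\mathscr P_k\to\mathscr P_k$ is defined, for $1\le i\le k$, by $$H_i(\mathbf p)=\sum_{n\ge2}q_n\sum_{m_0=0}^{n-1}\binom{n}{m_0}\mathbf p_0^{m_0}\sum_{(m_1,\dots,m_k)\in S^i_{n-m_0}}\binom{n-m_0}{m_1,\dots,m_k}\prod_{j=1}^k\mathbf p_j^{m_j},\qquad H_0(\mathbf p)=1-\sum_{j=1}^kH_j(\mathbf p),$$ with $S^i_r=\{(m_1,\dots,m_k)\in\mathbb N^k:\ m_j<m_i\ \forall j\ne i,\ \sum_{j=1}^km_j=r\}$. For $\mathbf p\in\mathscr P_k$, $\mathbf p(m)=(\mathbf p_0(m),\dots,\mathbf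 p_k(m)):=H^m(\mathbf p)$ (the $m$-th iterate); it is the law of the root's state in a Galton–Watson tree of height $m$ with offspring law $q$, when the leaves have i.i.d. states of law $\mathbf p$ ($0$ meaning undecided) and each parent takes the strict relative-majority opinion among its decided children, being undecided in case of a tie for the maximum or if all children are undecided. *)

theory Defs
  imports "HOL-Probability.Probability"
begin

text \<open>
  A vector indexed by \<open>0, \<dots>, k\<close> is encoded as a function on \<open>nat\<close> that vanishes above \<open>k\<close>.
  The offspring law is a \<open>nat pmf\<close>.
\<close>

definition prob_vectors :: "nat \<Rightarrow> (nat \<Rightarrow> real) set" where
  "prob_vectors k =
    {p. (\<forall>i\<le>k. p i \<ge> 0) \<and> (\<forall>i>k. p i = 0) \<and> (\<Sum>i=0..k. p i) = 1 \<and> p 0 < 1}"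

definition sorted_prob_vectors :: "nat \<Rightarrow> (nat \<Rightarrow> real) set" where
  "sorted_prob_vectors k =
    {p \<in> prob_vectors k. \<forall>i\<in>{1..k}. \<forall>j\<in>{1..k}. i \<le> j \<longrightarrow> p j \<le> p i}"

text \<open>
  Vote counts \<open>(m\<^sub>1, \<dots>, m\<^sub>k)\<close> of total \<open>r\<close> in which \<open>i\<close> is the strict relative majority;
  the entries outside \<open>{1..k}\<close> are set to \<open>0\<close>, which makes the set finite.
\<close>

definition majority_counts :: "nat \<Rightarrow> nat \<Rightarrow> nat \<Rightarrow> (nat \<Rightarrow> nat) set" where
  "majority_counts k i r =
    {m. (\<forall>j. j \<notin> {1..k} \<longrightarrow> m j = 0) \<and> (\<forall>j\<in>{1..k}. j \<noteq> i \<longrightarrow> m j < m i) \<and>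
        (\<Sum>j=1..k. m j) = r}"

definition multinomial :: "nat \<Rightarrow> nat \<Rightarrow> (nat \<Rightarrow> nat) \<Rightarrow> real" where
  "multinomial k r m = fact r / (\<Prod>j=1..k. fact (m j))"

definition majority_prob :: "nat pmf \<Rightarrow> nat \<Rightarrow> (nat \<Rightarrow> real) \<Rightarrow> nat \<Rightarrow> real" where
  "majority_prob q k p i =
    (\<Sum>\<^sub>\<infinity>n\<in>{2..}. pmf q n *
      (\<Sum>m\<^sub>0=0..n-1. real (n choose m\<^sub>0) * p 0 ^ m\<^sub>0 *
        (\<Sum>m\<in>majority_counts k i (n - m\<^sub>0).
          multinomial k (n - m\<^sub>0) m * (\<Prod>j=1..k. p j ^ m j))))"

text \<open>The map \<open>H\<close>: index \<open>0\<close> is the undecided state.\<close>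

definition majority_map :: "nat pmf \<Rightarrow> nat \<Rightarrow> (nat \<Rightarrow> real) \<Rightarrow> (nat \<Rightarrow> real)" where
  "majority_map q k p =
    (\<lambda>i. if i = 0 then 1 - (\<Sum>j=1..k. majority_prob q k p j)
         else if i \<le> k then majority_prob q k p i
         else 0)"

lemma finite_majority_counts: "finite (majority_counts k i r)"
proof (rule finite_subset)
  show "majority_counts k i r \<subseteq>
      {m. \<forall>j. (j \<in> {1..k} \<longrightarrow> m j \<in> {..r}) \<and> (j \<notin> {1..k} \<longrightarrow> m j = 0)}"
    by (auto simp: majority_counts_def intro!: member_le_sum)
  show "finite {m. \<forall>j. (j \<in> {1..k} \<longrightarrow> m j \<in> {..r}) \<and> (j \<notin> {1..k} \<longrightarrow> m j = (0::nat))}"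
    by (rule finite_set_of_finite_funs) auto
qed

end

theory Submission
  imports Defs
begin

text \<open>
  Let \<open>b\<close> be an opinion with \<open>p b < p a\<close>. Exchanging the roles of \<open>a\<close> and \<open>b\<close> maps the vote counts
  won by \<open>a\<close> bijectively onto those won by \<open>b\<close>, and the weight changes from
  \<open>(p a)\<^sup>x (p b)\<^sup>y\<close> to \<open>(p a)\<^sup>y (p b)\<^sup>x\<close> with \<open>y < x\<close>, i.e. by a factor at most \<open>p b / p a\<close>. Hence
  \<open>H\<^sub>b / H\<^sub>a \<le> p b / p a\<close>, strictly if \<open>p b > 0\<close> because of unanimous votes. Along the orbit the
  ratio therefore decreases to a limit \<open>r < 1\<close>. If the mass of \<open>b\<close> did not vanish, compactness
  would give a limit point \<open>L\<close> of the orbit with \<open>L b > 0\<close>; by continuity of \<open>H\<close> the ratio would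
  be \<open>r\<close> both at \<open>L\<close> and at \<open>H L\<close>, contradicting strictness.
\<close>

subsection \<open>Vote counts and the multinomial theorem\<close>

text \<open>Entries outside \<open>A\<close> are pinned to 0, so the set is finite and no count
  vector occurs twice. The index set is arbitrary to allow induction on it.\<close>

definition vote_counts :: "'a set \<Rightarrow> nat \<Rightarrow> ('a \<Rightarrow> nat) set" where
  "vote_counts A r = {m. (\<forall>j. j \<notin> A \<longrightarrow> m j = 0) \<and> sum m A = r}"

lemma finite_vote_counts:
  assumes "finite A"
  shows "finite (vote_counts A r)"
proof (rule finite_subset)
  show "vote_counts A r \<subseteq> {m. \<forall>j. (j \<in> A \<longrightarrow> m j \<in> {..r}) \<and> (j \<notin> A \<longrightarrow> m j = 0)}"
    using assms by (auto simp: vote_counts_def intro!: member_le_sum)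
  show "finite {m. \<forall>j. (j \<in> A \<longrightarrow> m j \<in> {..r}) \<and> (j \<notin> A \<longrightarrow> m j = (0::nat))}"
    using assms by (intro finite_set_of_finite_funs) auto
qed

lemma sum_vote_counts_insert:
  fixes g :: "('a \<Rightarrow> nat) \<Rightarrow> 'b :: comm_monoid_add"
  assumes "finite A" "a \<notin> A"
  shows "(\<Sum>m\<in>vote_counts (insert a A) r. g m) =
         (\<Sum>s\<le>r. \<Sum>m\<in>vote_counts A (r - s). g (m(a := s)))"
proof -
  have upd: "sum (m(a := s)) A = sum m A" for m :: "'a \<Rightarrow> nat" and s
    using assms by (intro sum.cong) auto
  have "(\<Sum>s\<le>r. \<Sum>m\<in>vote_counts A (r - s). g (m(a := s))) =
        (\<Sum>(s, m)\<in>Sigma {..r} (\<lambda>s. vote_counts A (r - s)). g (m(a := s)))"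
    using assms by (intro sum.Sigma) (auto simp: finite_vote_counts)
  also have "\<dots> = (\<Sum>m\<in>vote_counts (insert a A) r. g m)"
    using assms upd
    \<comment> \<open>Resetting the entry at \<open>a\<close> to 0 is what lands back in
      \<open>vote_counts A\<close>.\<close>
    by (intro sum.reindex_bij_witness
          [where i = "\<lambda>m. (m a, m(a := 0))" and j = "\<lambda>(s, m). m(a := s)"])
       (auto simp: vote_counts_def fun_eq_iff)
  finally show ?thesis by simp
qed

text \<open>With the factorials inside the product, the summand factorises over \<open>A\<close>.
  Splitting off the count of one new element then reduces the induction step to the binomial
  theorem.\<close>

lemma multinomial_theorem:
  fixes x :: "'a \<Rightarrow> real"
  assumes "finite A"
  shows "(\<Sum>m\<in>vote_counts A r. \<Prod>j\<in>A. x j ^ m j / fact (m j)) = sum x A ^ r / fact r"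
  using assms
proof (induction A arbitrary: r rule: finite_induct)
  case empty
  show ?case
  proof (cases "r = 0")
    case True
    then have "vote_counts {} r = {\<lambda>j::'a. 0}"
      by (auto simp: vote_counts_def)
    then show ?thesis using True by simp
  next
    case False
    then have "vote_counts {} r = ({} :: ('a \<Rightarrow> nat) set)"
      by (auto simp: vote_counts_def)
    then show ?thesis using False by simp
  qed
next
  case (insert a A)
  have upd: "(\<Prod>j\<in>A. x j ^ (m(a := s)) j / fact ((m(a := s)) j)) =
             (\<Prod>j\<in>A. x j ^ m j / fact (m j))" for m s
    using insert.hyps by (intro prod.cong) auto
  have "(\<Sum>m\<in>vote_counts (insert a A) r. \<Prod>j\<in>insert a A. x j ^ m j / fact (m j)) =
        (\<Sum>s\<le>r. \<Sum>m\<in>vote_counts A (r - s).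
           x a ^ s / fact s * (\<Prod>j\<in>A. x j ^ m j / fact (m j)))"
    unfolding sum_vote_counts_insert[OF insert.hyps(1,2)]
    using insert.hyps upd by simp
  also have "\<dots> = (\<Sum>s\<le>r. x a ^ s / fact s * (sum x A ^ (r - s) / fact (r - s)))"
    by (simp only: sum_distrib_left[symmetric] insert.IH)
  also have "\<dots> = (\<Sum>s\<le>r. real (r choose s) * x a ^ s * sum x A ^ (r - s)) / fact r"
    unfolding sum_divide_distrib by (intro sum.cong) (auto simp: binomial_fact)
  also have "\<dots> = sum x (insert a A) ^ r / fact r"
    using insert.hyps by (simp add: binomial_ring)
  finally show ?case .
qed

subsection \<open>The majority probability conditioned on the number of votes\<close>

definition majority_weight :: "nat \<Rightarrow> nat \<Rightarrow> (nat \<Rightarrow> real) \<Rightarrow> nat \<Rightarrow> real" where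
  "majority_weight k r p i =
    (\<Sum>m\<in>majority_counts k i r. multinomial k r m * (\<Prod>j=1..k. p j ^ m j))"

text \<open>This is the conditional probability that opinion \<open>i\<close> wins among
  \<open>n >= 1\<close> children, with \<open>s\<close> counting the undecided ones. At
  \<open>n = 0\<close> truncated subtraction leaves the summand \<open>s = 0\<close>; this value
  later gets the weight \<open>pmf q 0 = 0\<close>.\<close>

definition majority_poly :: "nat \<Rightarrow> nat \<Rightarrow> (nat \<Rightarrow> real) \<Rightarrow> nat \<Rightarrow> real" where
  "majority_poly k n p i =
    (\<Sum>s=0..n-1. real (n choose s) * p 0 ^ s * majority_weight k (n - s) p i)"

text \<open>Unlike \<open>prob_vectors\<close>, this includes the vector with all mass on 0 and is
  thus closed under pointwise limits, as the compactness argument requires.\<close>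

definition prob_simplex :: "nat \<Rightarrow> (nat \<Rightarrow> real) set" where
  "prob_simplex k = {p. (\<forall>i. 0 \<le> p i) \<and> (\<forall>i>k. p i = 0) \<and> (\<Sum>i=0..k. p i) = 1}"

lemma prob_vectors_subset_prob_simplex: "prob_vectors k \<subseteq> prob_simplex k"
proof
  fix p assume p: "p \<in> prob_vectors k"
  then have "0 \<le> p i" for i
    by (cases "i \<le> k") (auto simp: prob_vectors_def)
  with p show "p \<in> prob_simplex k" by (auto simp: prob_vectors_def prob_simplex_def)
qed

lemma multinomial_nonneg: "0 \<le> multinomial k r m"
  by (simp add: multinomial_def prod_nonneg)

lemma multinomial_pos: "0 < multinomial k r m"
  by (simp add: multinomial_def prod_pos)

lemma majority_weight_nonneg:
  assumes "\<And>j. 0 \<le> p j"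
  shows "0 \<le> majority_weight k r p i"
  unfolding majority_weight_def
  using assms by (intro sum_nonneg mult_nonneg_nonneg multinomial_nonneg prod_nonneg) auto

lemma majority_poly_nonneg:
  assumes "\<And>j. 0 \<le> p j"
  shows "0 \<le> majority_poly k n p i"
  unfolding majority_poly_def
  using assms by (intro sum_nonneg mult_nonneg_nonneg majority_weight_nonneg) auto

text \<open>At most one opinion can win strictly, so the winning sets are disjoint subsets of all
  vote counts, whose total weight is the multinomial expansion. Ties account for the
  inequality.\<close>

lemma sum_majority_weight_le:
  assumes "\<And>j. 0 \<le> p j"
  shows "(\<Sum>i=1..k. majority_weight k r p i) \<le> (\<Sum>j=1..k. p j) ^ r"
proof -
  let ?t = "\<lambda>m. multinomial k r m * (\<Prod>j=1..k. p j ^ m j)"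
  have disjoint: "majority_counts k i r \<inter> majority_counts k j r = {}"
    if "i \<in> {1..k}" "j \<in> {1..k}" "i \<noteq> j" for i j
    using that unfolding majority_counts_def by (blast dest: less_asym)
  have "(\<Sum>i=1..k. majority_weight k r p i) = sum ?t (\<Union>i\<in>{1..k}. majority_counts k i r)"
    unfolding majority_weight_def using disjoint
    by (intro sum.UNION_disjoint[symmetric]) (simp_all add: finite_majority_counts)
  also have "\<dots> \<le> sum ?t (vote_counts {1..k} r)"
    using assms
    by (intro sum_mono2 mult_nonneg_nonneg multinomial_nonneg prod_nonneg finite_vote_counts)
       (auto simp: majority_counts_def vote_counts_def)
  also have "\<dots> = fact r * (\<Sum>m\<in>vote_counts {1..k} r. \<Prod>j=1..k. p j ^ m j / fact (m j))"
    by (simp add: multinomial_def sum_distrib_left prod_dividef)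
  also have "\<dots> = (\<Sum>j=1..k. p j) ^ r"
    by (simp add: multinomial_theorem)
  finally show ?thesis .
qed

lemma sum_majority_poly_le_1:
  assumes "p \<in> prob_simplex k"
  shows "(\<Sum>i=1..k. majority_poly k n p i) \<le> 1"
proof -
  have nonneg: "0 \<le> p j" for j using assms by (auto simp: prob_simplex_def)
  define S where "S = (\<Sum>j=1..k. p j)"
  have S: "p 0 + S = 1"
    using assms by (simp add: prob_simplex_def S_def sum.atLeast_Suc_atMost)
  have "0 \<le> S" unfolding S_def by (intro sum_nonneg nonneg)
  have "(\<Sum>i=1..k. majority_poly k n p i) =
        (\<Sum>s=0..n-1. real (n choose s) * p 0 ^ s * (\<Sum>i=1..k. majority_weight k (n - s) p i))"
    unfolding majority_poly_def sum_distrib_left by (rule sum.swap)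
  also have "\<dots> \<le> (\<Sum>s=0..n-1. real (n choose s) * p 0 ^ s * S ^ (n - s))"
    unfolding S_def
    using nonneg by (intro sum_mono mult_left_mono sum_majority_weight_le) auto
  \<comment> \<open>Adding the case of all children undecided completes the binomial expansion of
    \<open>(p 0 + S) ^ n\<close>.\<close>
  also have "\<dots> \<le> (\<Sum>s\<le>n. real (n choose s) * p 0 ^ s * S ^ (n - s))"
    using nonneg \<open>0 \<le> S\<close> by (intro sum_mono2) auto
  also have "\<dots> = 1"
    using S by (simp add: binomial_ring[symmetric])
  finally show ?thesis .
qed

lemma majority_poly_le_1:
  assumes "p \<in> prob_simplex k" "i \<in> {1..k}"
  shows "majority_poly k n p i \<le> 1"
proof -
  have nonneg: "0 \<le> p j" for j using assms by (auto simp: prob_simplex_def)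
  have "majority_poly k n p i \<le> (\<Sum>i=1..k. majority_poly k n p i)"
    using assms by (intro member_le_sum majority_poly_nonneg nonneg) auto
  also have "\<dots> \<le> 1" by (rule sum_majority_poly_le_1) fact
  finally show ?thesis .
qed

lemma unanimous_in_majority_counts:
  assumes "a \<in> {1..k}" "0 < r"
  shows "(\<lambda>j. if j = a then r else 0) \<in> majority_counts k a r"
  using assms by (auto simp: majority_counts_def)

lemma majority_weight_pos:
  assumes "\<And>j. 0 \<le> p j" "a \<in> {1..k}" "0 < p a" "0 < r"
  shows "0 < majority_weight k r p a"
  unfolding majority_weight_def
proof (rule sum_pos2[OF finite_majority_counts unanimous_in_majority_counts])
  show "0 < multinomial k r (\<lambda>j. if j = a then r else 0) *
          (\<Prod>j=1..k. p j ^ (if j = a then r else 0))"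
    using assms by (intro mult_pos_pos multinomial_pos prod_pos) auto
qed (use assms in \<open>auto intro!: mult_nonneg_nonneg multinomial_nonneg prod_nonneg\<close>)

lemma majority_poly_pos:
  assumes "\<And>j. 0 \<le> p j" "a \<in> {1..k}" "0 < p a" "0 < n"
  shows "0 < majority_poly k n p a"
  unfolding majority_poly_def
  using assms
  by (intro sum_pos2[where i = 0])
     (auto intro!: mult_nonneg_nonneg majority_weight_nonneg majority_weight_pos)

subsection \<open>Comparison of two opinions\<close>

text \<open>Relabelling the opinions puts both weights on the same index set, so that they can be
  compared term by term.\<close>

lemma majority_weight_transpose:
  assumes "a \<in> {1..k}" "b \<in> {1..k}"
  shows "majority_weight k r p b =
    (\<Sum>m\<in>majority_counts k a r. multinomial k r m * (\<Prod>j=1..k. p j ^ m (Transposition.transpose a b j)))"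
proof -
  let ?\<tau> = "Transposition.transpose a b"
  have perm: "?\<tau> permutes {1..k}" using assms by (intro permutes_swap_id)
  \<comment> \<open>Stated for a general pair because the reindexing uses it in both directions,
    from \<open>a\<close> to \<open>b\<close> and back.\<close>
  have counts: "m \<circ> Transposition.transpose c d \<in> majority_counts k d r"
    if m: "m \<in> majority_counts k c r" and cd: "c \<in> {1..k}" "d \<in> {1..k}" for m c d
  proof -
    have perm': "Transposition.transpose c d permutes {1..k}" using cd by (intro permutes_swap_id)
    have "(\<Sum>j=1..k. m (Transposition.transpose c d j)) = (\<Sum>j=1..k. m j)"
      using sum.permute[OF perm', of m] by (simp add: o_def)
    moreover have "Transposition.transpose c d j \<in> {1..k} \<longleftrightarrow> j \<in> {1..k}" for j
      using permutes_in_image[OF perm'] .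
    moreover have "Transposition.transpose c d j \<noteq> c" if "j \<noteq> d" for j
      using that by (metis transpose_apply_second transpose_eq_imp_eq)
    ultimately show ?thesis
      using m unfolding majority_counts_def by auto
  qed
  have mult: "multinomial k r (m \<circ> ?\<tau>) = multinomial k r m" for m
    using prod.permute[OF perm, of "\<lambda>j. fact (m j) :: real"]
    by (simp add: multinomial_def o_def)
  show ?thesis
    unfolding majority_weight_def
    by (rule sum.reindex_bij_witness[where i = "\<lambda>m. m \<circ> ?\<tau>" and j = "\<lambda>m. m \<circ> ?\<tau>"])
       (use counts[OF _ assms] counts[OF _ assms(2,1)] mult
         in \<open>auto simp: o_def transpose_commute fun_eq_iff\<close>)
qed

lemma prod_transpose_diff:
  fixes p :: "nat \<Rightarrow> real"
  assumes "a \<in> A" "b \<in> A" "a \<noteq> b" "finite A"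
  defines "R \<equiv> \<lambda>m. \<Prod>j\<in>A - {a, b}. p j ^ m j"
  shows "(\<Prod>j\<in>A. p j ^ m j) = p a ^ m a * p b ^ m b * R m"
    and "(\<Prod>j\<in>A. p j ^ m (Transposition.transpose a b j)) = p a ^ m b * p b ^ m a * R m"
proof -
  have A: "A = insert a (insert b (A - {a, b}))" using assms by auto
  have split: "(\<Prod>j\<in>A. f j) = f a * f b * (\<Prod>j\<in>A - {a, b}. f j)" for f :: "nat \<Rightarrow> real"
    using assms by (subst A) (simp del: insert_Diff_single)
  show "(\<Prod>j\<in>A. p j ^ m j) = p a ^ m a * p b ^ m b * R m"
    unfolding R_def by (rule split)
  have "(\<Prod>j\<in>A - {a, b}. p j ^ m (Transposition.transpose a b j)) = R m"
    unfolding R_def by (intro prod.cong) (auto simp: Transposition.transpose_def)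
  then show "(\<Prod>j\<in>A. p j ^ m (Transposition.transpose a b j)) = p a ^ m b * p b ^ m a * R m"
    by (subst split) simp
qed

text \<open>With \<open>x = y + 1 + d\<close>, both sides share the factor
  \<open>(u * v) ^ (y + 1)\<close>, and what remains is \<open>v ^ d <= u ^ d\<close>. A lead of a
  single vote (\<open>d = 0\<close>) gives equality.\<close>

lemma swapped_powers_le:
  fixes u v :: real
  assumes "0 \<le> v" "v \<le> u" "y < x"
  shows "u * (u ^ y * v ^ x) \<le> v * (u ^ x * v ^ y)"
proof -
  obtain d where x: "x = y + 1 + d"
    using less_imp_Suc_add[OF assms(3)] by auto
  have "u ^ (y + 1) * v ^ (y + 1) * v ^ d \<le> u ^ (y + 1) * v ^ (y + 1) * u ^ d"
    using assms by (intro mult_left_mono power_mono) auto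
  then show ?thesis by (simp add: x power_add mult_ac)
qed

lemma swapped_term_le:
  assumes "\<And>j. 0 \<le> p j" "a \<in> {1..k}" "b \<in> {1..k}" "a \<noteq> b" "p b \<le> p a"
    and m: "m \<in> majority_counts k a r"
  shows "p a * (multinomial k r m * (\<Prod>j=1..k. p j ^ m (Transposition.transpose a b j))) \<le>
         p b * (multinomial k r m * (\<Prod>j=1..k. p j ^ m j))"
proof -
  define R where "R = (\<Prod>j\<in>{1..k} - {a, b}. p j ^ m j)"
  have "m b < m a" using m assms by (auto simp: majority_counts_def)
  then have "multinomial k r m * R * (p a * (p a ^ m b * p b ^ m a)) \<le>
             multinomial k r m * R * (p b * (p a ^ m a * p b ^ m b))"
    unfolding R_def using assms
    by (intro mult_left_mono swapped_powers_le mult_nonneg_nonneg multinomial_nonneg prod_nonneg)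
       auto
  then show ?thesis
    unfolding prod_transpose_diff[OF assms(2-4) finite_atLeastAtMost]
    by (simp add: R_def mult_ac)
qed

text \<open>The cross-multiplied form avoids dividing by quantities that may vanish. Its outer
  factors do not depend on \<open>r\<close>, so it survives averaging over the number of
  voters.\<close>

lemma majority_weight_ratio_le:
  assumes "\<And>j. 0 \<le> p j" "a \<in> {1..k}" "b \<in> {1..k}" "p b \<le> p a"
  shows "p a * majority_weight k r p b \<le> p b * majority_weight k r p a"
proof (cases "a = b")
  case False
  then show ?thesis
    unfolding majority_weight_transpose[OF assms(2,3)]
    unfolding majority_weight_def sum_distrib_left
    using assms by (intro sum_mono swapped_term_le)
qed simp

text \<open>The unanimous vote for \<open>a\<close> already gives a strict inequality,
  \<open>p a * p b ^ r < p b * p a ^ r\<close>. For \<open>r = 1\<close> its two sides would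
  coincide, hence the bound on \<open>r\<close>.\<close>

lemma majority_weight_ratio_less:
  assumes "\<And>j. 0 \<le> p j" "a \<in> {1..k}" "b \<in> {1..k}" "0 < p b" "p b < p a" "2 \<le> r"
  shows "p a * majority_weight k r p b < p b * majority_weight k r p a"
proof -
  have "a \<noteq> b" using assms by auto
  let ?m = "\<lambda>j. if j = a then r else 0"
  have "p a * (multinomial k r ?m * (\<Prod>j=1..k. p j ^ ?m (Transposition.transpose a b j))) <
        p b * (multinomial k r ?m * (\<Prod>j=1..k. p j ^ ?m j))"
  proof -
    obtain d where r: "r = Suc (Suc d)" using \<open>2 \<le> r\<close> by (metis add_2_eq_Suc le_Suc_ex)
    have "p b ^ Suc d < p a ^ Suc d"
      using assms by (intro power_strict_mono) auto
    then have "(p a * p b) * p b ^ Suc d < (p a * p b) * p a ^ Suc d"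
      using assms by (intro mult_strict_left_mono mult_pos_pos) auto
    then have "p a * p b ^ r < p b * p a ^ r" by (simp add: r mult_ac)
    then have "multinomial k r ?m * (p a * p b ^ r) < multinomial k r ?m * (p b * p a ^ r)"
      by (intro mult_strict_left_mono multinomial_pos)
    then show ?thesis
      unfolding prod_transpose_diff[OF assms(2,3) \<open>a \<noteq> b\<close> finite_atLeastAtMost]
      using \<open>a \<noteq> b\<close> by (simp add: mult_ac)
  qed
  then show ?thesis
    unfolding majority_weight_transpose[OF assms(2,3)]
    unfolding majority_weight_def sum_distrib_left
    using assms \<open>a \<noteq> b\<close> unanimous_in_majority_counts[of a k r]
    by (intro sum_strict_mono_ex1 finite_majority_counts ballI swapped_term_le) auto
qed

lemma majority_poly_ratio_le:
  assumes "\<And>j. 0 \<le> p j" "a \<in> {1..k}" "b \<in> {1..k}" "p b \<le> p a"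
  shows "p a * majority_poly k n p b \<le> p b * majority_poly k n p a"
proof -
  have "real (n choose s) * p 0 ^ s * (p a * majority_weight k (n - s) p b) \<le>
        real (n choose s) * p 0 ^ s * (p b * majority_weight k (n - s) p a)" for s
    using assms by (intro mult_left_mono majority_weight_ratio_le) auto
  then show ?thesis
    unfolding majority_poly_def sum_distrib_left by (intro sum_mono) (simp add: mult_ac)
qed

text \<open>Strictness comes from the summand without undecided children, where all
  \<open>n >= 2\<close> children vote. Its coefficient is 1 even if \<open>p 0 = 0\<close>, since
  \<open>0 ^ 0 = 1\<close>.\<close>

lemma majority_poly_ratio_less:
  assumes "\<And>j. 0 \<le> p j" "a \<in> {1..k}" "b \<in> {1..k}" "0 < p b" "p b < p a" "2 \<le> n"
  shows "p a * majority_poly k n p b < p b * majority_poly k n p a"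
proof -
  have "real (n choose s) * p 0 ^ s * (p a * majority_weight k (n - s) p b) \<le>
        real (n choose s) * p 0 ^ s * (p b * majority_weight k (n - s) p a)" for s
    using assms by (intro mult_left_mono majority_weight_ratio_le) auto
  moreover have "p a * majority_weight k n p b < p b * majority_weight k n p a"
    using assms by (intro majority_weight_ratio_less)
  ultimately show ?thesis
    unfolding majority_poly_def sum_distrib_left
    by (intro sum_strict_mono_ex1) (auto simp: mult_ac intro!: bexI[where x = 0])
qed

subsection \<open>Averaging over the offspring law\<close>

lemma sums_pmf_nat: "pmf (q :: nat pmf) sums 1"
proof -
  have "summable (\<lambda>n. norm (pmf q n))"
    using pmf_abs_summable[of q UNIV] by (simp only: abs_summable_on_nat_iff')
  moreover have "(\<Sum>n. pmf q n) = 1"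
    using infsetsum_nat'[OF pmf_abs_summable, of q] infsetsum_pmf_eq_1[of q UNIV] by simp
  ultimately show ?thesis by (simp add: sums_iff)
qed

text \<open>The conditional probabilities lie in the unit interval, so the series is dominated by
  \<open>pmf q\<close>. Extending the sum from \<open>n >= 2\<close> to all \<open>n\<close> adds
  only zero terms.\<close>

lemma majority_prob_sums:
  assumes q: "pmf q 0 + pmf q 1 = 0" and p: "p \<in> prob_simplex k" and i: "i \<in> {1..k}"
  shows "(\<lambda>n. pmf q n * majority_poly k n p i) sums majority_prob q k p i"
proof -
  let ?f = "\<lambda>n. pmf q n * majority_poly k n p i"
  have nonneg: "0 \<le> p j" for j using p by (auto simp: prob_simplex_def)
  have q01: "pmf q 0 = 0" "pmf q 1 = 0"
    using q pmf_nonneg[of q 0] pmf_nonneg[of q 1] by linarith+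
  have "summable (\<lambda>n. norm (?f n))"
  proof (rule summable_comparison_test')
    show "summable (pmf q)" using sums_pmf_nat sums_summable by blast
    show "norm (norm (?f n)) \<le> pmf q n" if "0 \<le> n" for n
      using majority_poly_nonneg[where p = p, OF nonneg] majority_poly_le_1[OF p i]
      by (simp add: mult_left_le)
  qed
  then have "?f summable_on UNIV"
    by (rule norm_summable_imp_summable_on)
  then have "?f sums (\<Sum>\<^sub>\<infinity>n. ?f n)"
    by (intro has_sum_imp_sums has_sum_infsum)
  moreover have "majority_prob q k p i = (\<Sum>\<^sub>\<infinity>n\<in>{2..}. ?f n)"
    unfolding majority_prob_def majority_poly_def majority_weight_def ..
  moreover have "(\<Sum>\<^sub>\<infinity>n\<in>{2..}. ?f n) = (\<Sum>\<^sub>\<infinity>n. ?f n)"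
  proof (rule infsum_cong_neutral)
    fix n :: nat assume "n \<in> UNIV - {2..}"
    then have "n = 0 \<or> n = 1" by auto
    then show "?f n = 0" using q01 by auto
  qed auto
  ultimately show ?thesis by simp
qed

lemma pmf_supported_ge_2:
  fixes q :: "nat pmf"
  assumes "pmf q 0 + pmf q 1 = 0"
  obtains n where "2 \<le> n" "0 < pmf q n"
proof -
  obtain n where n: "n \<in> set_pmf q" using set_pmf_not_empty[of q] by blast
  then have "0 < pmf q n" by (simp add: pmf_positive)
  moreover have "pmf q 0 = 0" "pmf q 1 = 0"
    using assms pmf_nonneg[of q 0] pmf_nonneg[of q 1] by linarith+
  then have "n \<noteq> 0" "n \<noteq> 1"
    using \<open>0 < pmf q n\<close> by (metis less_irrefl)+
  ultimately show ?thesis by (intro that[of n]) auto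
qed

lemma majority_prob_nonneg:
  assumes "pmf q 0 + pmf q 1 = 0" "p \<in> prob_simplex k" "i \<in> {1..k}"
  shows "0 \<le> majority_prob q k p i"
proof (rule sums_le[OF _ sums_zero majority_prob_sums[OF assms]])
  show "0 \<le> pmf q n * majority_poly k n p i" for n
    using assms by (auto simp: prob_simplex_def intro!: mult_nonneg_nonneg majority_poly_nonneg)
qed

lemma sum_majority_prob_le_1:
  assumes "pmf q 0 + pmf q 1 = 0" "p \<in> prob_simplex k"
  shows "(\<Sum>i=1..k. majority_prob q k p i) \<le> 1"
proof (rule sums_le[OF _ _ sums_pmf_nat])
  show "(\<lambda>n. pmf q n * (\<Sum>i=1..k. majority_poly k n p i)) sums (\<Sum>i=1..k. majority_prob q k p i)"
    unfolding sum_distrib_left using assms by (intro sums_sum majority_prob_sums)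
  show "pmf q n * (\<Sum>i=1..k. majority_poly k n p i) \<le> pmf q n" for n
    using sum_majority_poly_le_1[OF assms(2)] by (simp add: mult_left_le)
qed

lemma sums_strict_mono:
  fixes f g :: "nat \<Rightarrow> real"
  assumes "f sums s" "g sums t" "\<And>n. f n \<le> g n" "f i < g i"
  shows "s < t"
proof -
  have "(\<lambda>n. g n - f n) sums (t - s)" using assms by (intro sums_diff)
  moreover from this have "0 < (\<Sum>n. g n - f n)"
    using assms by (intro suminf_pos2[where i = i]) (auto simp: sums_iff)
  ultimately show ?thesis by (simp add: sums_iff)
qed

lemma majority_prob_pos:
  assumes "pmf q 0 + pmf q 1 = 0" "p \<in> prob_simplex k" "i \<in> {1..k}" "0 < p i"
  shows "0 < majority_prob q k p i"
proof -
  have nonneg: "0 \<le> p j" for j using assms by (auto simp: prob_simplex_def)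
  obtain n where n: "2 \<le> n" "0 < pmf q n" using pmf_supported_ge_2 assms(1) .
  show ?thesis
  proof (rule sums_strict_mono[OF sums_zero majority_prob_sums[OF assms(1-3)]])
    show "0 \<le> pmf q n * majority_poly k n p i" for n
      using nonneg by (intro mult_nonneg_nonneg majority_poly_nonneg) auto
    show "0 < pmf q n * majority_poly k n p i"
      using n nonneg assms by (intro mult_pos_pos majority_poly_pos) auto
  qed
qed

lemma majority_prob_ratio_le:
  assumes "pmf q 0 + pmf q 1 = 0" "p \<in> prob_simplex k"
    and "a \<in> {1..k}" "b \<in> {1..k}" "p b \<le> p a"
  shows "p a * majority_prob q k p b \<le> p b * majority_prob q k p a"
proof (rule sums_le[OF _ sums_mult[OF majority_prob_sums] sums_mult[OF majority_prob_sums]])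
  fix n
  have "pmf q n * (p a * majority_poly k n p b) \<le> pmf q n * (p b * majority_poly k n p a)"
    using assms by (intro mult_left_mono majority_poly_ratio_le) (auto simp: prob_simplex_def)
  then show "p a * (pmf q n * majority_poly k n p b) \<le> p b * (pmf q n * majority_poly k n p a)"
    by (simp add: mult_ac)
qed (use assms in auto)

text \<open>The inequality holds weakly for every \<open>n\<close> and strictly at some
  \<open>n >= 2\<close> charged by \<open>q\<close>, which suffices for the sums of the
  series.\<close>

lemma majority_prob_ratio_less:
  assumes "pmf q 0 + pmf q 1 = 0" "p \<in> prob_simplex k"
    and "a \<in> {1..k}" "b \<in> {1..k}" "0 < p b" "p b < p a"
  shows "p a * majority_prob q k p b < p b * majority_prob q k p a"
proof -
  have nonneg: "0 \<le> p j" for j using assms by (auto simp: prob_simplex_def)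
  obtain n where n: "2 \<le> n" "0 < pmf q n" using pmf_supported_ge_2 assms(1) .
  have sums: "(\<lambda>n. pmf q n * (p c * majority_poly k n p d)) sums (p c * majority_prob q k p d)"
    if "d \<in> {1..k}" for c d
    using sums_mult[OF majority_prob_sums[OF assms(1,2) that], of "p c"] by (simp add: mult_ac)
  show ?thesis
  proof (rule sums_strict_mono[OF sums sums])
    show "pmf q n * (p a * majority_poly k n p b) \<le> pmf q n * (p b * majority_poly k n p a)" for n
      using assms nonneg by (intro mult_left_mono majority_poly_ratio_le) auto
    show "pmf q n * (p a * majority_poly k n p b) < pmf q n * (p b * majority_poly k n p a)"
      using assms nonneg n by (intro mult_strict_left_mono majority_poly_ratio_less) auto
  qed (use assms in auto)
qed

subsection \<open>Dynamics\<close>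

lemma majority_map_in_prob_simplex:
  assumes "pmf q 0 + pmf q 1 = 0" "p \<in> prob_simplex k"
  shows "majority_map q k p \<in> prob_simplex k"
proof -
  have "(\<Sum>i=0..k. majority_map q k p i) = 1"
    by (simp add: majority_map_def sum.atLeast_Suc_atMost)
  then show ?thesis
    using majority_prob_nonneg[OF assms] sum_majority_prob_le_1[OF assms]
    by (auto simp: prob_simplex_def majority_map_def)
qed

text \<open>Each \<open>majority_poly\<close> is a polynomial in finitely many coordinates, and the
  uniform summable bound \<open>pmf q\<close> lets Tannery's theorem exchange limit and
  series.\<close>

lemma tendsto_majority_prob:
  assumes q: "pmf q 0 + pmf q 1 = 0" and X: "\<And>m. X m \<in> prob_simplex k" and L: "L \<in> prob_simplex k"
    and i: "i \<in> {1..k}" and lim: "\<And>j. (\<lambda>m. X m j) \<longlonglongrightarrow> L j"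
  shows "(\<lambda>m. majority_prob q k (X m) i) \<longlonglongrightarrow> majority_prob q k L i"
proof -
  have eq: "majority_prob q k p i = (\<Sum>n. pmf q n * majority_poly k n p i)"
    if "p \<in> prob_simplex k" for p
    using majority_prob_sums[OF q that i] by (simp add: sums_iff)
  have "(\<lambda>m. \<Sum>n. pmf q n * majority_poly k n (X m) i) \<longlonglongrightarrow> (\<Sum>n. pmf q n * majority_poly k n L i)"
  proof (rule tannerys_theorem[THEN conjunct2, THEN conjunct2])
    show "(\<lambda>m. pmf q n * majority_poly k n (X m) i) \<longlonglongrightarrow> pmf q n * majority_poly k n L i" for n
      unfolding majority_poly_def majority_weight_def by (intro tendsto_intros lim)
    show "\<forall>\<^sub>F (n, m) in at_top \<times>\<^sub>F sequentially.
            norm (pmf q n * majority_poly k n (X m) i) \<le> pmf q n"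
    proof (intro always_eventually allI, clarify)
      fix n m
      have "0 \<le> majority_poly k n (X m) i"
        using X[of m] by (intro majority_poly_nonneg) (auto simp: prob_simplex_def)
      then show "norm (pmf q n * majority_poly k n (X m) i) \<le> pmf q n"
        using majority_poly_le_1[OF X i] by (simp add: mult_left_le)
    qed
    show "summable (pmf q)" using sums_pmf_nat sums_summable by blast
  qed auto
  then show ?thesis using eq X L by simp
qed

text \<open>The simplex sits in a product of unit intervals, compact by Tychonoff and hence
  sequentially compact, as the countable product is first countable. The constraints involve finite
  sums and single coordinates, so they pass to the limit.\<close>

lemma prob_simplex_convergent_subsequence:
  assumes X: "\<And>m. X m \<in> prob_simplex k"
  obtains L and s :: "nat \<Rightarrow> nat"
  where "L \<in> prob_simplex k" "strict_mono s" "\<And>j. (\<lambda>m. X (s m) j) \<longlonglongrightarrow> L j"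
proof -
  let ?K = "PiE UNIV (\<lambda>j. {0..1}) :: (nat \<Rightarrow> real) set"
  have "compact ?K"
    using compactin_PiE[of "\<lambda>j. euclidean" UNIV "\<lambda>j::nat. {0..1::real}"]
    by (simp add: euclidean_product_topology)
  then have "seq_compact ?K" by (rule compact_imp_seq_compact)
  moreover have "X m \<in> ?K" for m
  proof -
    have "X m j \<le> 1" for j
    proof (cases "j \<le> k")
      case True
      then have "X m j \<le> (\<Sum>j=0..k. X m j)"
        using X[of m] by (intro member_le_sum) (auto simp: prob_simplex_def)
      then show ?thesis using X[of m] by (auto simp: prob_simplex_def)
    qed (use X[of m] in \<open>auto simp: prob_simplex_def\<close>)
    then show ?thesis using X[of m] by (auto simp: prob_simplex_def)
  qed
  ultimately obtain L s where s: "strict_mono s" and "(X \<circ> s) \<longlonglongrightarrow> L"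
    unfolding seq_compact_def by blast
  then have lim: "(\<lambda>m. X (s m) j) \<longlonglongrightarrow> L j" for j
    using continuous_on_tendsto_compose[OF continuous_on_product_coordinates[of j]]
    by (simp add: o_def)
  have "(\<lambda>m. \<Sum>j=0..k. X (s m) j) \<longlonglongrightarrow> (\<Sum>j=0..k. L j)"
    by (intro tendsto_intros lim)
  then have "(\<Sum>j=0..k. L j) = 1"
    using X by (simp add: prob_simplex_def LIMSEQ_const_iff)
  moreover have "0 \<le> L j" for j
    using X by (intro LIMSEQ_le_const[OF lim]) (auto simp: prob_simplex_def)
  moreover have "L j = 0" if "j > k" for j
    using lim[of j] X that by (simp add: prob_simplex_def LIMSEQ_const_iff)
  ultimately have "L \<in> prob_simplex k" by (auto simp: prob_simplex_def)
  then show ?thesis using s lim by (rule that)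
qed

lemma dominated_opinion_vanishes:
  assumes q: "pmf q 0 + pmf q 1 = 0" and p: "p \<in> prob_simplex k"
    and ab: "a \<in> {1..k}" "b \<in> {1..k}" and less: "p b < p a"
  shows "(\<lambda>m. ((majority_map q k ^^ m) p) b) \<longlonglongrightarrow> 0"
proof -
  define X where "X m = (majority_map q k ^^ m) p" for m
  have X_0: "X 0 = p" and X_Suc: "X (Suc m) = majority_map q k (X m)" for m
    by (simp_all add: X_def)
  have X: "X m \<in> prob_simplex k" for m
    by (induction m) (simp_all add: X_0 X_Suc p majority_map_in_prob_simplex[OF q])
  have X_Suc_prob: "X (Suc m) i = majority_prob q k (X m) i" if "i \<in> {1..k}" for m i
    using that by (simp add: X_Suc majority_map_def)
  have nonneg: "0 \<le> X m j" for m j using X[of m] by (auto simp: prob_simplex_def)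
  have X_less: "X m b < X m a" for m
  proof (induction m)
    case (Suc m)
    have pos: "0 < X m a" using Suc nonneg[of m b] by simp
    have "0 < X (Suc m) a"
      unfolding X_Suc_prob[OF ab(1)] by (rule majority_prob_pos[OF q X ab(1) pos])
    \<comment> \<open>The ratio bound and the induction hypothesis together give the claim
      multiplied by \<open>X m a > 0\<close>, which is then cancelled.\<close>
    have "X m a * X (Suc m) b \<le> X m b * X (Suc m) a"
      unfolding X_Suc_prob[OF ab(1)] X_Suc_prob[OF ab(2)]
      using Suc by (intro majority_prob_ratio_le q X ab) auto
    also have "\<dots> < X m a * X (Suc m) a"
      using Suc \<open>0 < X (Suc m) a\<close> by (rule mult_strict_right_mono)
    finally show ?case using pos by simp
  qed (simp add: X_0 less)
  have pos: "0 < X m a" for m using X_less[of m] nonneg[of m b] by simp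

  text \<open>
    The values of \<open>X\<close> at \<open>a\<close> may tend to \<open>0\<close>, which is harmless since they dominate those
    at \<open>b\<close>; hence only limit points with a positive entry at \<open>b\<close> have to be excluded.
  \<close>
  define \<rho> where "\<rho> m = X m b / X m a" for m
  have \<rho>: "X m b = \<rho> m * X m a" for m
    using pos[of m] by (simp add: \<rho>_def)
  have \<rho>_nonneg: "0 \<le> \<rho> m" for m
    using pos[of m] nonneg[of m b] by (simp add: \<rho>_def)
  have "\<rho> (Suc m) \<le> \<rho> m" for m
  proof -
    have "X m a * X (Suc m) b \<le> X m b * X (Suc m) a"
      unfolding X_Suc_prob[OF ab(1)] X_Suc_prob[OF ab(2)]
      using X_less[of m] by (intro majority_prob_ratio_le q X ab) auto
    then show ?thesis
      using pos[of m] pos[of "Suc m"] by (simp add: \<rho>_def divide_simps mult_ac)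
  qed
  then have dec: "decseq \<rho>" by (rule decseq_SucI)
  then obtain r where r: "\<rho> \<longlonglongrightarrow> r" "\<And>m. r \<le> \<rho> m"
    using decseq_convergent[of \<rho> 0] \<rho>_nonneg by auto
  have "\<rho> 0 < 1" using X_less[of 0] pos[of 0] by (simp add: \<rho>_def)
  then have "r < 1" using r(2)[of 0] by simp

  show ?thesis
  proof (rule ccontr)
    assume "\<not> ?thesis"
    then have "\<not> (\<lambda>m. X m b) \<longlonglongrightarrow> 0" by (simp add: X_def)
    then obtain e where "0 < e" and freq: "\<And>N. \<exists>m\<ge>N. e \<le> X m b"
      using nonneg by (auto simp: LIMSEQ_def not_less)
    have "infinite {m. e \<le> X m b}"
      unfolding infinite_nat_iff_unbounded_le using freq by auto
    \<comment> \<open>Enumerating the times at which \<open>b\<close> keeps mass at least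
      \<open>e\<close> yields a subsequence whose limit points have a positive entry at
      \<open>b\<close>.\<close>
    define t where "t = enumerate {m. e \<le> X m b}"
    have t: "strict_mono t" "e \<le> X (t m) b" for m
      using \<open>infinite _\<close> enumerate_in_set[of "{m. e \<le> X m b}" m]
      by (auto simp: t_def strict_mono_enumerate)
    obtain L s where L: "L \<in> prob_simplex k" and s: "strict_mono s"
      and lim: "\<And>j. (\<lambda>m. X (t (s m)) j) \<longlonglongrightarrow> L j"
      using prob_simplex_convergent_subsequence[of "\<lambda>m. X (t m)" k] X by blast
    have "e \<le> L b" using t(2) by (intro LIMSEQ_le_const[OF lim]) auto
    then have "0 < L b" using \<open>0 < e\<close> by simp
    \<comment> \<open>The shifted times also form a subsequence, so \<rho> tends to the same
      \<open>r\<close> along both.\<close>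
    have ts: "strict_mono (\<lambda>m. t (s m))" "strict_mono (\<lambda>m. Suc (t (s m)))"
      using s t(1) by (auto simp: strict_mono_def)
    \<comment> \<open>The limit is taken in the product form of the ratio, because
      \<open>L a > 0\<close> is not known yet; it will follow from \<open>L b = r * L a\<close> and
      \<open>L b > 0\<close>.\<close>
    have "(\<lambda>m. \<rho> (t (s m)) * X (t (s m)) a) \<longlonglongrightarrow> r * L a"
      using LIMSEQ_subseq_LIMSEQ[OF r(1) ts(1)] by (intro tendsto_mult lim) (simp add: o_def)
    then have L_b: "L b = r * L a"
      using lim[of b] by (simp add: \<rho>[symmetric] LIMSEQ_unique)
    have lim_Suc: "(\<lambda>m. X (Suc (t (s m))) i) \<longlonglongrightarrow> majority_prob q k L i" if "i \<in> {1..k}" for i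
      unfolding X_Suc_prob[OF that] using that by (intro tendsto_majority_prob q X L lim)
    have "(\<lambda>m. \<rho> (Suc (t (s m))) * X (Suc (t (s m))) a) \<longlonglongrightarrow> r * majority_prob q k L a"
      using LIMSEQ_subseq_LIMSEQ[OF r(1) ts(2)]
      by (intro tendsto_mult lim_Suc ab) (simp add: o_def)
    then have H_b: "majority_prob q k L b = r * majority_prob q k L a"
      using lim_Suc[OF ab(2)] by (simp add: \<rho>[symmetric] LIMSEQ_unique)
    have "0 \<le> L a" using L by (simp add: prob_simplex_def)
    then have "0 < L a" using \<open>0 < L b\<close> L_b by (cases "L a = 0") auto
    then have "L b < L a" using L_b \<open>r < 1\<close> by simp
    then have "L a * majority_prob q k L b < L b * majority_prob q k L a"
      using \<open>0 < L b\<close> by (intro majority_prob_ratio_less q L ab)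
    \<comment> \<open>Both sides of the strict inequality equal
      \<open>r * L a * majority_prob q k L a\<close>.\<close>
    then show False by (simp add: L_b H_b)
  qed
qed

theorem lemma2p5:
  fixes q :: "nat pmf" and i k :: nat and p :: "nat \<Rightarrow> real"
  assumes "pmf q 0 + pmf q 1 = 0"
    and "integrable (measure_pmf q) (\<lambda>n. real n * (real n - 1))"
    and "1 \<le> i" and "i < k"
    and "p \<in> sorted_prob_vectors k"
    and "\<forall>j\<in>{1..i}. p j = p 1"
    and "p i > p (i + 1)"
  shows "\<forall>j\<in>{i+1..k}. (\<lambda>m. ((majority_map q k ^^ m) p) j) \<longlonglongrightarrow> 0"
proof
  fix j assume j: "j \<in> {i+1..k}"
  then have "p j \<le> p (i + 1)"
    using assms(3-5) by (auto simp: sorted_prob_vectors_def)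
  moreover have "p \<in> prob_simplex k"
    using assms(5) prob_vectors_subset_prob_simplex by (auto simp: sorted_prob_vectors_def)
  ultimately show "(\<lambda>m. ((majority_map q k ^^ m) p) j) \<longlonglongrightarrow> 0"
    \<comment> \<open>Opinion \<open>i\<close> itself can serve as the dominating one:
      \<open>p j <= p (i + 1) < p i\<close>.\<close>
    using assms(1,3,4,7) j by (intro dominated_opinion_vanishes[where a = i]) auto
qed

end
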